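(* Let $W$ be a Brown-Resnick stationary process as in the context, with associated max-stable stationary process $\xi_W$. Let $(r_n)_{n\ge 1}$ be positive integers such that $\lim_{n\to\infty} r_n=\lim_{n\to\infty} n/r_n=\infty$. Then for every $\delta\in(0,\infty)$ the limit $$\widetilde{\theta_W^\delta}:=\lim_{n\to\infty}\frac{n}{r_n}\,\mathbb{P}\Bigl\{\max_{t\in\{0,\delta,\ldots,\delta r_n\}}\xi_W(t)>n\Bigr\}$$ exists and satisfies $$\widetilde{\theta_W^\delta}=\theta_W^\delta\in[0,\infty).$$
   Context: Let $B(t),t\in\mathbb{R}$, be a real-valued random process with càdlàg sample paths, with $B(0)=0$ almost surely and $\mathbb{E}\{e^{B(t)}\}<\infty$ for all $t\in\mathbb{R}$. Set $W(t)=B(t)-\ln\mathbb{E}\{e^{B(t)}\}$, $t\in\mathbb{R}$, so that $W(0)=0$ almost surely and $\mathbb{E}\{e^{W(t)}\}=1$ for all $t$. Let $\sum_{i\ge1}\varepsilon_{P_i}$ be a Poisson point process on $(0,\infty)$ with intensity $x^{-2}dx$ ($\varepsilon_x$ is the unit Dirac measure at $x$), and let $W_i$, $i\ge1$, be independent copies of $W$, independent of this Poisson point process. Define the max-stable process $\xi_W(t)=\max_{i\ge1}P_ie^{W_i(t)}$, $t\in\mathbb{R}$, which has unit Fréchet marginals. $W$ is called Brown-Resnick stationary if $\xi_W$ is stationary, i.e. $\{\xi_W(t),t\in\mathbb{R}\}$ and $\{\xi_W(t+h),t\in\mathbb{R}\}$ have the same distribution for every $h\in\mathbb{R}$. For $\delta>0$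 the Pickands-type constant is $$\mathcal{H}_W^\delta=\lim_{T\to\infty}\frac1T\,\mathbb{E}\Bigl\{\sup_{t\in\delta\mathbb{Z}\cap[0,T]}e^{W(t)}\Bigr\},$$ a limit which exists and is finite when $W$ is Brown-Resnick stationary, and $\theta_W^\delta:=\delta\mathcal{H}_W^\delta$ is the extremal index of the stationary sequence $\xi_W(\delta i)$, $i\in\mathbb{Z}$. *)

theory Defs
  imports "HOL-Probability.Probability"
begin

definition cadlag :: "(real \<Rightarrow> 'b::topological_space) \<Rightarrow> bool" where
  "cadlag f \<longleftrightarrow> (\<forall>t. continuous (at_right t) f \<and> (\<exists>l. (f \<longlongrightarrow> l) (at_left t)))"

text \<open>
  Processes indexed by the real line are regarded as random elements of the full product
  space with the product sigma-algebra, so equality of laws is equality of all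
  finite-dimensional distributions.
\<close>

definition path_law :: "'w measure \<Rightarrow> (real \<Rightarrow> 'w \<Rightarrow> 'b::topological_space) \<Rightarrow> (real \<Rightarrow> 'b) measure" where
  "path_law M X = distr M (\<Pi>\<^sub>M t\<in>UNIV. borel) (\<lambda>\<omega> t. X t \<omega>)"

definition stationary :: "'w measure \<Rightarrow> (real \<Rightarrow> 'w \<Rightarrow> 'b::topological_space) \<Rightarrow> bool" where
  "stationary M X \<longleftrightarrow> (\<forall>h. path_law M (\<lambda>t. X (t + h)) = path_law M X)"

definition dirac_sum :: "(nat \<Rightarrow> 'w \<Rightarrow> 'x) \<Rightarrow> 'x set \<Rightarrow> 'w \<Rightarrow> ennreal" where
  "dirac_sum X A \<omega> = (\<Sum>i. indicator A (X i \<omega>))"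

text \<open>
  The points \<^term>\<open>X i\<close> enumerate a Poisson point process with intensity measure \<^term>\<open>\<mu>\<close>
  on the state space \<^term>\<open>space \<mu>\<close>: the number of points in a set is Poisson distributed
  (infinite almost surely if the set has infinite intensity), and the numbers of points in
  disjoint sets are independent. Finite families of disjoint sets are covered by padding
  with the empty set. All natural numbers are used as indices, so the number of points is
  infinite.
\<close>

definition poisson_point_process :: "'w measure \<Rightarrow> 'x measure \<Rightarrow> (nat \<Rightarrow> 'w \<Rightarrow> 'x) \<Rightarrow> bool" where
  "poisson_point_process N \<mu> X \<longleftrightarrow>
     (\<forall>i. X i \<in> N \<rightarrow>\<^sub>M \<mu>) \<and>
     (\<forall>A\<in>sets \<mu>. emeasure \<mu> A < \<infinity> \<longrightarrow>
        (\<forall>k::nat. measure N {\<omega> \<in> space N. dirac_sum X A \<omega> = of_nat k} =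
                   exp (- measure \<mu> A) * measure \<mu> A ^ k / fact k)) \<and>
     (\<forall>A\<in>sets \<mu>. emeasure \<mu> A = \<infinity> \<longrightarrow> (AE \<omega> in N. dirac_sum X A \<omega> = \<infinity>)) \<and>
     (\<forall>A::nat \<Rightarrow> 'x set. range A \<subseteq> sets \<mu> \<longrightarrow> disjoint_family A \<longrightarrow>
        prob_space.indep_vars N (\<lambda>_. borel) (\<lambda>j. dirac_sum X (A j)) UNIV)"

definition frechet_intensity :: "real measure" where
  "frechet_intensity = density (restrict_space lborel {0<..}) (\<lambda>x. ennreal (1 / x\<^sup>2))"

definition log_normalized :: "'w measure \<Rightarrow> (real \<Rightarrow> 'w \<Rightarrow> real) \<Rightarrow> real \<Rightarrow> 'w \<Rightarrow> real" where
  "log_normalized M B t \<omega> = B t \<omega> - ln (\<integral>\<omega>'. exp (B t \<omega>') \<partial>M)"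

text \<open>
  The library's \<^const>\<open>prob_space.indep_var\<close> requires both random elements to take values
  in the same type; here they may have different types.
\<close>

definition indep_elements ::
  "'w measure \<Rightarrow> 'x measure \<Rightarrow> ('w \<Rightarrow> 'x) \<Rightarrow> 'y measure \<Rightarrow> ('w \<Rightarrow> 'y) \<Rightarrow> bool" where
  "indep_elements N E X F Y \<longleftrightarrow>
     X \<in> N \<rightarrow>\<^sub>M E \<and> Y \<in> N \<rightarrow>\<^sub>M F \<and>
     prob_space.indep_set N {X -` A \<inter> space N | A. A \<in> sets E} {Y -` A \<inter> space N | A. A \<in> sets F}"

text \<open>
  The points and the copies may live on a probability space \<^term>\<open>N\<close> other than that of
  \<^term>\<open>W\<close>. The copies are independent of the whole sequence \<^term>\<open>P\<close>: independence of the
  random point measure alone would leave the enumeration free to depend on the copies.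
\<close>

definition brown_resnick_representation ::
  "'w measure \<Rightarrow> (real \<Rightarrow> 'w \<Rightarrow> real) \<Rightarrow>
   'v measure \<Rightarrow> (nat \<Rightarrow> 'v \<Rightarrow> real) \<Rightarrow> (nat \<Rightarrow> real \<Rightarrow> 'v \<Rightarrow> real) \<Rightarrow> bool" where
  "brown_resnick_representation M W N P V \<longleftrightarrow>
     poisson_point_process N frechet_intensity P \<and>
     (\<forall>i t. V i t \<in> borel_measurable N) \<and>
     (\<forall>i. path_law N (V i) = path_law M W) \<and>
     prob_space.indep_vars N (\<lambda>_. \<Pi>\<^sub>M t\<in>UNIV. borel) (\<lambda>i \<omega> t. V i t \<omega>) UNIV \<and>
     indep_elements N
       (\<Pi>\<^sub>M i\<in>UNIV. frechet_intensity) (\<lambda>\<omega> i. P i \<omega>)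
       (\<Pi>\<^sub>M i\<in>UNIV. \<Pi>\<^sub>M t\<in>UNIV. borel) (\<lambda>\<omega> i t. V i t \<omega>)"

text \<open>
  The maximum over the infinitely many points is a supremum, taken in the extended
  half-line so that it is defined on every sample point; it is finite and attained almost surely
  at each time.
\<close>

definition max_stable_process ::
  "(nat \<Rightarrow> 'v \<Rightarrow> real) \<Rightarrow> (nat \<Rightarrow> real \<Rightarrow> 'v \<Rightarrow> real) \<Rightarrow> real \<Rightarrow> 'v \<Rightarrow> ennreal" where
  "max_stable_process P V t \<omega> = (SUP i. ennreal (P i \<omega> * exp (V i t \<omega>)))"

definition pickands_average ::
  "'w measure \<Rightarrow> (real \<Rightarrow> 'w \<Rightarrow> real) \<Rightarrow> real \<Rightarrow> real \<Rightarrow> real" where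
  "pickands_average M W \<delta> T =
     1 / T * (\<integral>\<omega>. (SUP t\<in>range (\<lambda>k::int. \<delta> * of_int k) \<inter> {0..T}. exp (W t \<omega>)) \<partial>M)"

definition pickands_const :: "'w measure \<Rightarrow> (real \<Rightarrow> 'w \<Rightarrow> real) \<Rightarrow> real \<Rightarrow> real" where
  "pickands_const M W \<delta> = Lim at_top (pickands_average M W \<delta>)"

definition extremal_index :: "'w measure \<Rightarrow> (real \<Rightarrow> 'w \<Rightarrow> real) \<Rightarrow> real \<Rightarrow> real" where
  "extremal_index M W \<delta> = \<delta> * pickands_const M W \<delta>"

end

theory Submission
  imports Defs
begin

text \<open>
  By the void probabilities of the Poisson process of points \<open>P i\<close> marked with the paths \<open>V i\<close>,
  the maximum of \<open>\<xi>\<close> over a finite set \<open>K\<close> of times exceeds \<open>x\<close> with probability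
  \<open>1 - exp (- a K / x)\<close>, where \<open>a K\<close> is the expected maximum of \<open>exp (W t)\<close> over \<open>K\<close>.
  Stationarity of \<open>\<xi>\<close> therefore makes \<open>a\<close> invariant under shifts of \<open>K\<close>, so
  \<open>a {0, \<delta>, \<dots>, \<delta> (n - 1)}\<close> is subadditive in \<open>n\<close> and, divided by \<open>n\<close>, has a limit, which is the
  extremal index. As \<open>r n / n\<close> tends to \<open>0\<close>, the exponent at level \<open>x = n\<close> vanishes and
  \<open>1 - exp (- u)\<close> may be replaced by \<open>u\<close>.
\<close>

section \<open>Laplace functional of a Poisson point process\<close>

text \<open>Extends \<open>exp (- y)\<close> to \<open>y = \<infinity>\<close>, so that infinite sums over the points and zero factors are covered.\<close>

definition exp_neg :: "ennreal \<Rightarrow> real" where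
  "exp_neg y = (if y = \<infinity> then 0 else exp (- enn2real y))"

lemma exp_neg_top [simp]: "exp_neg top = 0"
  by (simp add: exp_neg_def)

lemma exp_neg_0 [simp]: "exp_neg 0 = 1"
  by (simp add: exp_neg_def)

lemma exp_neg_ennreal: "0 \<le> x \<Longrightarrow> exp_neg (ennreal x) = exp (- x)"
  by (simp add: exp_neg_def)

lemma exp_neg_nonneg [simp]: "0 \<le> exp_neg y"
  by (simp add: exp_neg_def)

lemma exp_neg_le_1 [simp]: "exp_neg y \<le> 1"
  by (simp add: exp_neg_def)

lemma borel_measurable_exp_neg [measurable]: "exp_neg \<in> borel_measurable borel"
  unfolding exp_neg_def[abs_def] by measurable

lemma exp_neg_add: "exp_neg (x + y) = exp_neg x * exp_neg y"
  by (cases x; cases y) (auto simp: exp_neg_ennreal mult_exp_exp simp flip: ennreal_plus)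

lemma exp_neg_sum: "finite A \<Longrightarrow> exp_neg (sum f A) = (\<Prod>i\<in>A. exp_neg (f i))"
  by (induction A rule: finite_induct) (auto simp: exp_neg_add)

lemma exp_neg_antimono: "x \<le> y \<Longrightarrow> exp_neg y \<le> exp_neg x"
  by (cases x; cases y) (auto simp: exp_neg_ennreal top_unique)

text \<open>At a finite point this is continuity of \<open>exp\<close> composed with
  \<open>enn2real\<close>; at infinity it says that \<open>exp (- r)\<close> tends to
  \<open>0\<close>. It lets monotone limits of infinite sums pass through
  \<open>exp_neg\<close>.\<close>

lemma continuous_on_exp_neg: "continuous_on UNIV exp_neg"
proof -
  have "((\<lambda>y. exp_neg y) \<longlongrightarrow> exp_neg x) (at x)" for x
  proof (cases x)
    case (real r)
    have "\<forall>\<^sub>F y in at x. y < top"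
      using real by (intro order_tendstoD(2)[OF tendsto_ident_at]) auto
    moreover have "((\<lambda>y. exp (- enn2real y)) \<longlongrightarrow> exp (- enn2real x)) (at x)"
      using real by (intro tendsto_intros tendsto_enn2real) auto
    moreover have "exp_neg x = exp (- enn2real x)"
      using real by (simp add: exp_neg_def)
    moreover have "exp_neg y = exp (- enn2real y)" if "y < top" for y
      using that by (simp add: exp_neg_def)
    ultimately show ?thesis
      by (metis (mono_tags, lifting) Lim_transform_eventually eventually_mono)
  next
    case top
    have "\<forall>\<^sub>F y in at x. \<bar>exp_neg y\<bar> < e" if e: "e > 0" for e
    proof -
      \<comment> \<open>Solving \<open>exp (- r) < e\<close> gives the threshold
        \<open>- ln e\<close>. It is cut off at \<open>0\<close> because \<open>ennreal\<close>
        would collapse a negative threshold.\<close>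
      define c where "c = max 0 (- ln e)"
      have "\<forall>\<^sub>F y in at x. ennreal c < y"
        using top by (intro order_tendstoD(1)[OF tendsto_ident_at]) auto
      then show ?thesis
      proof (rule eventually_mono)
        fix y assume y: "ennreal c < y"
        show "\<bar>exp_neg y\<bar> < e"
        proof (cases y)
          case (real r)
          then have "c < r" using y ennreal_less_iff[of c r] by (simp add: c_def)
          then have "- ln e < r" by (simp add: c_def)
          then have "exp (- r) < e"
            using e by (metis exp_less_cancel_iff exp_ln minus_less_iff)
          then show ?thesis using real by (simp add: exp_neg_ennreal)
        qed (use e in simp)
      qed
    qed
    then show ?thesis using top
      by (intro tendstoI) (auto simp: dist_real_def)
  qed
  then show ?thesis by (auto simp: continuous_on)
qed

lemma tendsto_exp_neg: "(f \<longlongrightarrow> l) F \<Longrightarrow> ((\<lambda>x. exp_neg (f x)) \<longlongrightarrow> exp_neg l) F"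
  using continuous_on_tendsto_compose[OF continuous_on_exp_neg] by auto

text \<open>Any factor \<open>1 - q\<close> in the unit interval becomes a value of
  \<open>exp_neg\<close>, so that products of such factors turn into sums. The value
  \<open>q = 1\<close> requires the exponent infinity.\<close>

lemma exp_neg_eq_one_minus:
  assumes "0 \<le> q" "q \<le> 1"
  shows "exp_neg (if q < 1 then ennreal (- ln (1 - q)) else \<infinity>) = 1 - q"
  using assms by (auto simp: exp_neg_ennreal)

text \<open>The sum is the counting measure of the set of indices \<open>i\<close> with
  \<open>x i\<close> in \<open>A\<close>, hence a natural number or infinite.\<close>

lemma suminf_indicator_cases:
  obtains k where "(\<Sum>i. indicator A (x i) :: ennreal) = of_nat k"
  | "(\<Sum>i. indicator A (x i) :: ennreal) = \<infinity>"
proof -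
  have "(\<Sum>i. indicator A (x i) :: ennreal) = (\<integral>\<^sup>+ i. indicator (x -` A) i \<partial>count_space UNIV)"
    unfolding nn_integral_count_space_nat by (intro suminf_cong) (simp split: split_indicator)
  also have "\<dots> = emeasure (count_space UNIV) (x -` A)"
    by simp
  finally show ?thesis
    using that emeasure_count_space[of "x -` A" UNIV] by (auto split: if_splits)
qed

lemma borel_measurable_dirac_sum:
  assumes "poisson_point_process N \<mu> X" "A \<in> sets \<mu>"
  shows "dirac_sum X A \<in> borel_measurable N"
proof -
  have [measurable]: "X i \<in> N \<rightarrow>\<^sub>M \<mu>" "A \<in> sets \<mu>" for i
    using assms by (auto simp: poisson_point_process_def)
  show ?thesis unfolding dirac_sum_def[abs_def] by measurable
qed

text \<open>This is the Laplace transform of the Poisson distribution, obtained by summing the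
  exponential series; for infinite intensity the count is almost surely infinite and both sides
  vanish as soon as \<open>c\<close> is positive.\<close>

lemma integral_exp_neg_dirac_sum:
  assumes "prob_space N" and ppp: "poisson_point_process N \<mu> X" and A: "A \<in> sets \<mu>" and c: "c < \<infinity>"
  shows "(\<integral>\<omega>. exp_neg (c * dirac_sum X A \<omega>) \<partial>N) = exp_neg (ennreal (1 - exp_neg c) * emeasure \<mu> A)"
proof -
  interpret prob_space N by fact
  note D[measurable] = borel_measurable_dirac_sum[OF ppp A]
  have cases: "(\<exists>k. dirac_sum X A \<omega> = of_nat k) \<or> dirac_sum X A \<omega> = \<infinity>" for \<omega>
    unfolding dirac_sum_def by (rule suminf_indicator_cases[of A "\<lambda>i. X i \<omega>"]) auto
  obtain r where r: "c = ennreal r" "r \<ge> 0" using c by (cases c) auto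
  show ?thesis
  \<comment> \<open>With \<open>0 * \<infinity> = 0\<close> both sides equal \<open>1\<close> here
    even if the count or the intensity is infinite; for positive \<open>r\<close> the product with
    infinity is infinite.\<close>
  proof (cases "r = 0")
    case True
    then show ?thesis by (simp add: r prob_space)
  next
    case False
    with r have r0: "r > 0" by auto
    show ?thesis
    proof (cases "emeasure \<mu> A = \<infinity>")
      case True
      have "AE \<omega> in N. dirac_sum X A \<omega> = \<infinity>"
        using ppp A True by (auto simp: poisson_point_process_def)
      then have "AE \<omega> in N. exp_neg (c * dirac_sum X A \<omega>) = 0"
        by eventually_elim (use r0 in \<open>auto simp: r ennreal_mult_top\<close>)
      then have "(\<integral>\<omega>. exp_neg (c * dirac_sum X A \<omega>) \<partial>N) = 0"
        by (subst integral_cong_AE[where g="\<lambda>_. 0"]) auto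
      then show ?thesis using True r0
        by (simp add: r exp_neg_ennreal ennreal_mult_top)
    next
      case False
      define m where "m = measure \<mu> A"
      have m: "emeasure \<mu> A = ennreal m" "m \<ge> 0"
        using False by (auto simp: m_def emeasure_eq_ennreal_measure)
      define E where "E k = {\<omega> \<in> space N. dirac_sum X A \<omega> = of_nat k}" for k :: nat
      have E[measurable]: "E k \<in> sets N" for k unfolding E_def by measurable
      have prob: "measure N (E k) = exp (- m) * m ^ k / fact k" for k
        using ppp A False unfolding poisson_point_process_def E_def m_def
        by (auto simp: less_top)
      \<comment> \<open>The events \<open>E k\<close> are disjoint and cover the sample points with
        finite count. Where the count is infinite, both sides are \<open>0\<close>.\<close>
      have pw: "ennreal (exp_neg (c * dirac_sum X A \<omega>)) =
          (\<Sum>k. ennreal (exp (- r * real k)) * indicator (E k) \<omega>)" if \<omega>: "\<omega> \<in> space N" for \<omega>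
      proof (cases "dirac_sum X A \<omega> = \<infinity>")
        case True
        then show ?thesis using r0 by (simp add: r ennreal_mult_top E_def)
      next
        case False
        then obtain k0 where k0: "dirac_sum X A \<omega> = of_nat k0" using cases by auto
        have "(\<Sum>k. ennreal (exp (- r * real k)) * indicator (E k) \<omega>)
            = (\<Sum>k\<in>{k0}. ennreal (exp (- r * real k)) * indicator (E k) \<omega>)"
          using k0 by (intro suminf_finite) (auto simp: E_def)
        moreover have "c * of_nat k0 = ennreal (r * real k0)"
          using r by (simp add: ennreal_of_nat_eq_real_of_nat ennreal_mult)
        ultimately show ?thesis using r0 \<omega>
          by (simp add: k0 E_def exp_neg_ennreal)
      qed
      have sums: "(\<lambda>k. exp (- r * real k) * (exp (- m) * m ^ k / fact k)) sums exp (- (m * (1 - exp (- r))))"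
      proof -
        have "(\<lambda>k. (m * exp (- r)) ^ k /\<^sub>R fact k) sums exp (m * exp (- r))"
          by (rule exp_converges)
        from sums_mult[OF this, of "exp (- m)"]
        have "(\<lambda>k. exp (- m) * ((m * exp (- r)) ^ k /\<^sub>R fact k)) sums (exp (- m) * exp (m * exp (- r)))" .
        moreover have "exp (- m) * ((m * exp (- r)) ^ k /\<^sub>R fact k) = exp (- r * real k) * (exp (- m) * m ^ k / fact k)" for k
          by (simp add: power_mult_distrib exp_of_nat_mult[symmetric] field_simps)
        moreover have "exp (- m) * exp (m * exp (- r)) = exp (- (m * (1 - exp (- r))))"
          by (simp add: exp_add[symmetric] algebra_simps)
        ultimately show ?thesis by simp
      qed
      have "(\<integral>\<^sup>+\<omega>. ennreal (exp_neg (c * dirac_sum X A \<omega>)) \<partial>N) =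
          (\<integral>\<^sup>+\<omega>. (\<Sum>k. ennreal (exp (- r * real k)) * indicator (E k) \<omega>) \<partial>N)"
        by (intro nn_integral_cong pw)
      also have "\<dots> = (\<Sum>k. \<integral>\<^sup>+\<omega>. ennreal (exp (- r * real k)) * indicator (E k) \<omega> \<partial>N)"
        by (intro nn_integral_suminf) measurable
      also have "\<dots> = (\<Sum>k. ennreal (exp (- r * real k) * (exp (- m) * m ^ k / fact k)))"
        by (intro suminf_cong)
          (simp only: nn_integral_cmult_indicator E emeasure_eq_measure prob exp_ge_zero ennreal_mult')
      also have "\<dots> = ennreal (exp (- (m * (1 - exp (- r)))))"
        using m by (intro suminf_ennreal_eq sums) auto
      finally have "(\<integral>\<omega>. exp_neg (c * dirac_sum X A \<omega>) \<partial>N) = exp (- (m * (1 - exp (- r))))"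
        by (intro integral_eq_nn_integral[THEN trans]) (auto simp: )
      then show ?thesis using m r
        by (simp add: exp_neg_ennreal mult.commute flip: ennreal_mult)
    qed
  qed
qed

text \<open>A simple function is a finite combination of indicators of its level sets. These are
  disjoint, so their counts are independent and the expectation splits into Poisson Laplace
  transforms.\<close>

lemma laplace_poisson_simple:
  assumes "prob_space N" and ppp: "poisson_point_process N \<mu> X"
    and s: "simple_function \<mu> s" and fin: "\<And>x. s x < \<infinity>"
  shows "(\<integral>\<omega>. exp_neg (\<Sum>i. s (X i \<omega>)) \<partial>N) = exp_neg (\<integral>\<^sup>+x. ennreal (1 - exp_neg (s x)) \<partial>\<mu>)"
proof -
  interpret prob_space N by fact
  have X[measurable]: "X i \<in> N \<rightarrow>\<^sub>M \<mu>" for i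
    using ppp by (auto simp: poisson_point_process_def)
  have "finite (s ` space \<mu>)" using s by (rule simple_functionD)
  from ex_bij_betw_nat_finite[OF this] obtain n :: nat and c where c: "bij_betw c {0..<n} (s ` space \<mu>)"
    by auto
  \<comment> \<open>Independence of counts is stated for infinite sequences of disjoint sets, hence
    the padding by empty sets from \<open>n\<close> on.\<close>
  define A where "A j = (if j < n then s -` {c j} \<inter> space \<mu> else {})" for j
  have A: "A j \<in> sets \<mu>" for j
    using simple_functionD(2)[OF s] by (auto simp: A_def)
  have disj: "disjoint_family A"
    using bij_betw_imp_inj_on[OF c] by (auto simp: disjoint_family_on_def A_def inj_on_def)
  have cfin: "c j < \<infinity>" if "j < n" for j
    using bij_betwE[OF c] that fin by (metis atLeastLessThan_iff imageE le0)
  \<comment> \<open>Exactly one level set contains \<open>x\<close>, so the decomposition holds for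
    every \<open>F\<close>. It is applied to the identity in the sum over the points and to
    \<open>1 - exp_neg\<close> in the integral.\<close>
  have decomp: "F (s x) = (\<Sum>j<n. F (c j) * indicator (A j) x)"
    if x: "x \<in> space \<mu>" for x and F :: "ennreal \<Rightarrow> ennreal"
  proof -
    obtain j0 where j0: "j0 < n" "s x = c j0"
      using bij_betw_imp_surj_on[OF c] x by (metis atLeastLessThan_iff imageE imageI)
    have "indicator (A j) x = (if j = j0 then 1 else 0 :: ennreal)" if "j < n" for j
      using bij_betw_imp_inj_on[OF c] that j0 x by (auto simp: A_def inj_on_def indicator_def)
    then have "(\<Sum>j<n. F (c j) * indicator (A j) x) = (\<Sum>j<n. if j = j0 then F (c j) else 0)"
      by (intro sum.cong) auto
    then show ?thesis using j0 by simp
  qed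
  have "(\<integral>\<omega>. exp_neg (\<Sum>i. s (X i \<omega>)) \<partial>N) = (\<integral>\<omega>. (\<Prod>j<n. exp_neg (c j * dirac_sum X (A j) \<omega>)) \<partial>N)"
  proof (intro Bochner_Integration.integral_cong refl)
    fix \<omega> assume "\<omega> \<in> space N"
    then have "X i \<omega> \<in> space \<mu>" for i using X by (auto simp: measurable_def)
    then have "(\<Sum>i. s (X i \<omega>)) = (\<Sum>i. \<Sum>j<n. c j * indicator (A j) (X i \<omega>))"
      using decomp[of _ "\<lambda>x. x"] by simp
    also have "\<dots> = (\<Sum>j<n. c j * dirac_sum X (A j) \<omega>)"
      unfolding dirac_sum_def by (subst suminf_sum) (auto simp: ennreal_suminf_cmult)
    finally show "exp_neg (\<Sum>i. s (X i \<omega>)) = (\<Prod>j<n. exp_neg (c j * dirac_sum X (A j) \<omega>))"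
      by (simp add: exp_neg_sum)
  qed
  also have "\<dots> = (\<Prod>j<n. \<integral>\<omega>. exp_neg (c j * dirac_sum X (A j) \<omega>) \<partial>N)"
  proof (rule indep_vars_lebesgue_integral)
    have "indep_vars (\<lambda>_. borel) (\<lambda>j. dirac_sum X (A j)) UNIV"
      using ppp A disj unfolding poisson_point_process_def by (meson image_subsetI)
    then have "indep_vars (\<lambda>_. borel) (\<lambda>j. dirac_sum X (A j)) {..<n}"
      by (rule indep_vars_subset) auto
    then show "indep_vars (\<lambda>_. borel) (\<lambda>j \<omega>. exp_neg (c j * dirac_sum X (A j) \<omega>)) {..<n}"
      by (rule indep_vars_compose2) measurable
    show "integrable N (\<lambda>\<omega>. exp_neg (c j * dirac_sum X (A j) \<omega>))" for j
      using borel_measurable_dirac_sum[OF ppp A]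
      by (intro integrable_const_bound[of _ 1]) auto
  qed auto
  also have "\<dots> = (\<Prod>j<n. exp_neg (ennreal (1 - exp_neg (c j)) * emeasure \<mu> (A j)))"
    using cfin by (intro prod.cong refl integral_exp_neg_dirac_sum assms A) auto
  also have "\<dots> = exp_neg (\<Sum>j<n. ennreal (1 - exp_neg (c j)) * emeasure \<mu> (A j))"
    by (simp add: exp_neg_sum)
  also have "(\<Sum>j<n. ennreal (1 - exp_neg (c j)) * emeasure \<mu> (A j)) =
      (\<integral>\<^sup>+x. (\<Sum>j<n. ennreal (1 - exp_neg (c j)) * indicator (A j) x) \<partial>\<mu>)"
    using A by (subst nn_integral_sum) (auto simp: nn_integral_cmult_indicator)
  also have "\<dots> = (\<integral>\<^sup>+x. ennreal (1 - exp_neg (s x)) \<partial>\<mu>)"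
    by (intro nn_integral_cong decomp[of _ "\<lambda>y. ennreal (1 - exp_neg y)", symmetric])
  finally show ?thesis .
qed

text \<open>Simple functions increase to \<open>h\<close>. The left side converges by dominated
  convergence with bound \<open>1\<close>, the integral on the right by monotone convergence, and
  continuity of \<open>exp_neg\<close> at infinity covers divergent sums and integrals.\<close>

lemma laplace_poisson:
  assumes "prob_space N" and ppp: "poisson_point_process N \<mu> X"
    and h: "h \<in> borel_measurable \<mu>"
  shows "(\<integral>\<omega>. exp_neg (\<Sum>i. h (X i \<omega>)) \<partial>N) = exp_neg (\<integral>\<^sup>+x. ennreal (1 - exp_neg (h x)) \<partial>\<mu>)"
proof -
  interpret prob_space N by fact
  have X[measurable]: "X i \<in> N \<rightarrow>\<^sub>M \<mu>" for i
    using ppp by (auto simp: poisson_point_process_def)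
  obtain f where f: "\<And>i. simple_function \<mu> (f i)" "incseq f" "\<And>i x. f i x < top" "\<And>x. (SUP i. f i x) = h x"
    using borel_measurable_implies_simple_function_sequence'[OF h] by blast
  have fm[measurable]: "f n \<in> borel_measurable \<mu>" for n
    using f(1) by (rule borel_measurable_simple_function)
  have inc: "incseq (\<lambda>n. f n x)" for x
    using f(2) by (auto simp: incseq_def le_fun_def)
  have lim: "(\<lambda>n. f n x) \<longlonglongrightarrow> h x" for x
    using LIMSEQ_SUP[OF inc[of x]] f(4) by simp
  have "(\<lambda>n. \<integral>\<omega>. exp_neg (\<Sum>i. f n (X i \<omega>)) \<partial>N) \<longlonglongrightarrow> (\<integral>\<omega>. exp_neg (\<Sum>i. h (X i \<omega>)) \<partial>N)"
  proof (rule integral_dominated_convergence[where w="\<lambda>_. 1"])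
    have "(\<lambda>n. \<Sum>i. f n (X i \<omega>)) \<longlonglongrightarrow> (\<Sum>i. h (X i \<omega>))" for \<omega>
    proof -
      have "(\<Sum>i. h (X i \<omega>)) = (SUP n. \<Sum>i. f n (X i \<omega>))"
        unfolding f(4)[symmetric] by (rule ennreal_suminf_SUP_eq) (use f(2) in \<open>auto simp: incseq_def le_fun_def\<close>)
      moreover have "incseq (\<lambda>n. \<Sum>i. f n (X i \<omega>))"
        using f(2) by (auto simp: incseq_def le_fun_def intro!: suminf_le)
      ultimately show ?thesis using LIMSEQ_SUP by metis
    qed
    then show "AE \<omega> in N. (\<lambda>n. exp_neg (\<Sum>i. f n (X i \<omega>))) \<longlonglongrightarrow> exp_neg (\<Sum>i. h (X i \<omega>))"
      by (intro AE_I2 tendsto_exp_neg)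
  qed (use h in auto)
  moreover have "(\<lambda>n. exp_neg (\<integral>\<^sup>+x. ennreal (1 - exp_neg (f n x)) \<partial>\<mu>)) \<longlonglongrightarrow>
      exp_neg (\<integral>\<^sup>+x. ennreal (1 - exp_neg (h x)) \<partial>\<mu>)"
  proof (rule tendsto_exp_neg, rule nn_integral_LIMSEQ)
    show "incseq (\<lambda>n x. ennreal (1 - exp_neg (f n x)))"
      using f(2) by (auto simp: incseq_def le_fun_def intro!: ennreal_leI exp_neg_antimono)
    show "(\<lambda>n. ennreal (1 - exp_neg (f n x))) \<longlonglongrightarrow> ennreal (1 - exp_neg (h x))" for x
      by (intro tendsto_ennrealI tendsto_intros tendsto_exp_neg lim)
  qed auto
  moreover have "(\<integral>\<omega>. exp_neg (\<Sum>i. f n (X i \<omega>)) \<partial>N) = exp_neg (\<integral>\<^sup>+x. ennreal (1 - exp_neg (f n x)) \<partial>\<mu>)" for n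
    using f by (intro laplace_poisson_simple[OF assms(1,2)]) auto
  ultimately show ?thesis
    using LIMSEQ_unique by auto
qed

section \<open>Void probabilities of a marked Poisson point process\<close>

text \<open>Independence is the product formula on rectangles, and a product of sigma-finite
  measures is determined by its values there.\<close>

lemma distr_pair_indep_elements:
  assumes "prob_space N" and ind: "indep_elements N E X F Y"
  shows "distr N (E \<Otimes>\<^sub>M F) (\<lambda>\<omega>. (X \<omega>, Y \<omega>)) = distr N E X \<Otimes>\<^sub>M distr N F Y"
proof -
  interpret prob_space N by fact
  have [measurable]: "X \<in> N \<rightarrow>\<^sub>M E" "Y \<in> N \<rightarrow>\<^sub>M F"
    and set: "indep_set {X -` A \<inter> space N | A. A \<in> sets E} {Y -` A \<inter> space N | A. A \<in> sets F}"
    using ind by (auto simp: indep_elements_def)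
  interpret X: prob_space "distr N E X" by (rule prob_space_distr) measurable
  interpret Y: prob_space "distr N F Y" by (rule prob_space_distr) measurable
  show ?thesis
  proof (rule pair_measure_eqI[symmetric])
    fix A B assume "A \<in> sets (distr N E X)" "B \<in> sets (distr N F Y)"
    then have [measurable]: "A \<in> sets E" "B \<in> sets F" by auto
    have "(\<lambda>\<omega>. (X \<omega>, Y \<omega>)) -` (A \<times> B) \<inter> space N = (X -` A \<inter> space N) \<inter> (Y -` B \<inter> space N)"
      by auto
    moreover have "prob ((X -` A \<inter> space N) \<inter> (Y -` B \<inter> space N)) = prob (X -` A \<inter> space N) * prob (Y -` B \<inter> space N)"
      by (rule indep_setD[OF set]) auto
    ultimately show "emeasure (distr N E X) A * emeasure (distr N F Y) B =
        emeasure (distr N (E \<Otimes>\<^sub>M F) (\<lambda>\<omega>. (X \<omega>, Y \<omega>))) (A \<times> B)"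
      by (simp add: emeasure_distr emeasure_eq_measure ennreal_mult)
  next
    show "sets (distr N E X \<Otimes>\<^sub>M distr N F Y) = sets (distr N (E \<Otimes>\<^sub>M F) (\<lambda>\<omega>. (X \<omega>, Y \<omega>)))"
      by (simp cong: sets_pair_measure_cong)
  qed (rule X.sigma_finite_measure_axioms Y.sigma_finite_measure_axioms)+
qed

text \<open>Given the points \<open>x i\<close>, the independent marks avoid \<open>C\<close> with
  probability the product of \<open>1 - q (x i)\<close>, where \<open>q x\<close> is the
  \<open>Q\<close>-mass of the section of \<open>C\<close> at \<open>x\<close>. Averaging over the
  points is a Laplace functional at \<open>h\<close> with \<open>1 - exp_neg (h x) = q x\<close>,
  and integrating \<open>q\<close> gives the product measure of \<open>C\<close>.\<close>

lemma marked_poisson_void_probability: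
  assumes N: "prob_space N" and ppp: "poisson_point_process N \<mu> X"
    and Y: "\<And>i. Y i \<in> N \<rightarrow>\<^sub>M S" and law: "\<And>i. distr N S (Y i) = Q"
    and iid: "prob_space.indep_vars N (\<lambda>_. S) Y UNIV"
    and ind: "indep_elements N (\<Pi>\<^sub>M i\<in>UNIV. \<mu>) (\<lambda>\<omega> i. X i \<omega>) (\<Pi>\<^sub>M i\<in>UNIV. S) (\<lambda>\<omega> i. Y i \<omega>)"
    and C: "C \<in> sets (\<mu> \<Otimes>\<^sub>M S)"
  shows "measure N {\<omega> \<in> space N. \<forall>i. (X i \<omega>, Y i \<omega>) \<notin> C} = exp_neg (emeasure (\<mu> \<Otimes>\<^sub>M Q) C)"
proof -
  interpret prob_space N by fact
  note Y[measurable] C[measurable]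
  have X[measurable]: "X i \<in> N \<rightarrow>\<^sub>M \<mu>" for i
    using ppp by (auto simp: poisson_point_process_def)
  interpret Q: prob_space Q
    unfolding law[of 0, symmetric] by (rule prob_space_distr) measurable
  have sets_Q[measurable_cong]: "sets Q = sets S"
    unfolding law[of 0, symmetric] by simp
  let ?PX = "\<Pi>\<^sub>M i\<in>(UNIV::nat set). \<mu>" and ?PY = "\<Pi>\<^sub>M i\<in>(UNIV::nat set). S"
  have XX[measurable]: "(\<lambda>\<omega> i. X i \<omega>) \<in> N \<rightarrow>\<^sub>M ?PX" and YY[measurable]: "(\<lambda>\<omega> i. Y i \<omega>) \<in> N \<rightarrow>\<^sub>M ?PY"
    using ind by (auto simp: indep_elements_def)
  interpret PY: prob_space "distr N ?PY (\<lambda>\<omega> i. Y i \<omega>)" by (rule prob_space_distr) measurable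
  define q where "q x = measure Q (Pair x -` C)" for x
  have q[measurable]: "q \<in> borel_measurable \<mu>"
    unfolding q_def[abs_def] Sigma_Algebra.measure_def using C
    by (intro measurable_compose[OF Q.measurable_emeasure_Pair]) (simp_all cong: sets_pair_measure_cong)
  have q01: "0 \<le> q x" "q x \<le> 1" for x by (auto simp: q_def)
  \<comment> \<open>Chosen as \<open>- ln (1 - q x)\<close>, so that the product of the avoidance
    probabilities is \<open>exp_neg\<close> of a sum over the points.\<close>
  define h where "h x = (if q x < 1 then ennreal (- ln (1 - q x)) else \<infinity>)" for x
  have h[measurable]: "h \<in> borel_measurable \<mu>" unfolding h_def[abs_def] by measurable
  have eh: "exp_neg (h x) = 1 - q x" for x
    unfolding h_def using q01 by (rule exp_neg_eq_one_minus)
  define V where "V n = {\<omega> \<in> space N. \<forall>i<n. (X i \<omega>, Y i \<omega>) \<notin> C}" for n :: nat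
  have V[measurable]: "V n \<in> sets N" for n unfolding V_def by measurable

  have section_prob: "prob {\<omega> \<in> space N. \<forall>i<n. (x i, Y i \<omega>) \<notin> C} = (\<Prod>i<n. 1 - q (x i))"
    if x: "\<And>i. x i \<in> space \<mu>" for x n
  \<comment> \<open>The case of no points is separate: an empty intersection is the whole type
    instead of \<open>space N\<close>, and the product rule for independent variables asks for a
    nonempty index set.\<close>
  proof (cases "n = 0")
    case True
    then show ?thesis by (simp add: prob_space)
  next
    case False
    define A where "A i = space S - Pair (x i) -` C" for i
    have A: "A i \<in> sets S" for i unfolding A_def using sets_Pair1[OF C] by auto
    have "{\<omega> \<in> space N. \<forall>i<n. (x i, Y i \<omega>) \<notin> C} = (\<Inter>i\<in>{..<n}. Y i -` A i \<inter> space N)"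
      using False measurable_space[OF Y] by (auto simp: A_def)
    also have "prob \<dots> = (\<Prod>i<n. prob (Y i -` A i \<inter> space N))"
      using A False by (intro indep_varsD[OF iid]) auto
    also have "\<dots> = (\<Prod>i<n. 1 - q (x i))"
    proof (intro prod.cong refl)
      fix i
      have "prob (Y i -` A i \<inter> space N) = measure Q (A i)"
        using A by (simp flip: law[of i] add: measure_distr)
      also have "\<dots> = 1 - q (x i)"
        unfolding A_def q_def using sets_Pair1[OF C] sets_Q sets_eq_imp_space_eq[OF sets_Q] Q.prob_compl by metis
      finally show "prob (Y i -` A i \<inter> space N) = 1 - q (x i)" .
    qed
    finally show ?thesis .
  qed

  \<comment> \<open>The joint law of points and marks is a product, so by Fubini the points may be
    frozen at \<open>\<omega>'\<close> while the marks are integrated out;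
    \<open>section_prob\<close> then applies.\<close>
  have finite_void: "prob (V n) = (\<integral>\<omega>. exp_neg (\<Sum>i<n. h (X i \<omega>)) \<partial>N)" for n
  proof -
    define D where "D = {z \<in> space (?PX \<Otimes>\<^sub>M ?PY). \<forall>i<n. (fst z i, snd z i) \<notin> C}"
    have [measurable]: "(\<lambda>z. fst z i) \<in> ?PX \<Otimes>\<^sub>M ?PY \<rightarrow>\<^sub>M \<mu>" "(\<lambda>z. snd z i) \<in> ?PX \<Otimes>\<^sub>M ?PY \<rightarrow>\<^sub>M S" for i
      by (auto intro!: measurable_compose[OF measurable_fst] measurable_compose[OF measurable_snd] measurable_component_singleton)
    have D[measurable]: "D \<in> sets (?PX \<Otimes>\<^sub>M ?PY)" unfolding D_def by measurable
    have spX: "(\<lambda>i. X i \<omega>) \<in> space ?PX" and spY: "(\<lambda>i. Y i \<omega>) \<in> space ?PY" if "\<omega> \<in> space N" for \<omega>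
      using that measurable_space[OF XX] measurable_space[OF YY] by auto
    have "emeasure N (V n) = emeasure (distr N (?PX \<Otimes>\<^sub>M ?PY) (\<lambda>\<omega>. (\<lambda>i. X i \<omega>, \<lambda>i. Y i \<omega>))) D"
      by (subst emeasure_distr) (auto simp: V_def D_def space_pair_measure intro!: arg_cong[where f="emeasure N"] spX spY)
    also have "\<dots> = (\<integral>\<^sup>+x. emeasure (distr N ?PY (\<lambda>\<omega> i. Y i \<omega>)) (Pair x -` D) \<partial>distr N ?PX (\<lambda>\<omega> i. X i \<omega>))"
      unfolding distr_pair_indep_elements[OF N ind]
      by (rule PY.emeasure_pair_measure_alt) (use D in \<open>simp cong: sets_pair_measure_cong\<close>)
    also have "\<dots> = (\<integral>\<^sup>+\<omega>'. emeasure (distr N ?PY (\<lambda>\<omega> i. Y i \<omega>)) (Pair (\<lambda>i. X i \<omega>') -` D) \<partial>N)"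
      by (intro nn_integral_distr XX PY.measurable_emeasure_Pair) (use D in \<open>simp cong: sets_pair_measure_cong\<close>)
    also have "\<dots> = (\<integral>\<^sup>+\<omega>'. ennreal (exp_neg (\<Sum>i<n. h (X i \<omega>'))) \<partial>N)"
    proof (rule nn_integral_cong)
      fix \<omega>' assume \<omega>': "\<omega>' \<in> space N"
      have "emeasure (distr N ?PY (\<lambda>\<omega> i. Y i \<omega>)) (Pair (\<lambda>i. X i \<omega>') -` D) =
          emeasure N ((\<lambda>\<omega> i. Y i \<omega>) -` (Pair (\<lambda>i. X i \<omega>') -` D) \<inter> space N)"
        by (intro emeasure_distr YY sets_Pair1[OF D])
      also have "(\<lambda>\<omega> i. Y i \<omega>) -` (Pair (\<lambda>i. X i \<omega>') -` D) \<inter> space N = {\<omega> \<in> space N. \<forall>i<n. (X i \<omega>', Y i \<omega>) \<notin> C}"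
        using spX[OF \<omega>'] spY by (auto simp: D_def space_pair_measure)
      also have "emeasure N \<dots> = ennreal (\<Prod>i<n. 1 - q (X i \<omega>'))"
        using measurable_space[OF X \<omega>'] by (simp add: emeasure_eq_measure section_prob)
      finally show "emeasure (distr N ?PY (\<lambda>\<omega> i. Y i \<omega>)) (Pair (\<lambda>i. X i \<omega>') -` D) =
          ennreal (exp_neg (\<Sum>i<n. h (X i \<omega>')))"
        by (simp add: exp_neg_sum eh)
    qed
    finally have "(\<integral>\<^sup>+\<omega>. ennreal (exp_neg (\<Sum>i<n. h (X i \<omega>))) \<partial>N) = ennreal (prob (V n))"
      by (simp add: emeasure_eq_measure)
    then show ?thesis
      by (subst integral_eq_nn_integral) auto
  qed

  \<comment> \<open>Two evaluations of the same limit: the events \<open>V n\<close> decrease to the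
    void event, and the integrals converge by domination by \<open>1\<close>.\<close>
  have "(\<lambda>n. prob (V n)) \<longlonglongrightarrow> prob (\<Inter>n. V n)"
    by (rule finite_Lim_measure_decseq) (auto simp: decseq_def V_def)
  moreover have "(\<Inter>n. V n) = {\<omega> \<in> space N. \<forall>i. (X i \<omega>, Y i \<omega>) \<notin> C}"
    by (auto simp: V_def)
  moreover have "(\<lambda>n. prob (V n)) \<longlonglongrightarrow> (\<integral>\<omega>. exp_neg (\<Sum>i. h (X i \<omega>)) \<partial>N)"
    unfolding finite_void
  proof (rule integral_dominated_convergence[where w="\<lambda>_. 1"])
    show "AE \<omega> in N. (\<lambda>n. exp_neg (\<Sum>i<n. h (X i \<omega>))) \<longlonglongrightarrow> exp_neg (\<Sum>i. h (X i \<omega>))"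
      by (intro AE_I2 tendsto_exp_neg summable_LIMSEQ summableI)
  qed auto
  ultimately have "measure N {\<omega> \<in> space N. \<forall>i. (X i \<omega>, Y i \<omega>) \<notin> C} = (\<integral>\<omega>. exp_neg (\<Sum>i. h (X i \<omega>)) \<partial>N)"
    using LIMSEQ_unique by metis
  also have "\<dots> = exp_neg (\<integral>\<^sup>+x. ennreal (q x) \<partial>\<mu>)"
    by (simp add: laplace_poisson[OF N ppp h] eh)
  also have "(\<integral>\<^sup>+x. ennreal (q x) \<partial>\<mu>) = emeasure (\<mu> \<Otimes>\<^sub>M Q) C"
    by (subst Q.emeasure_pair_measure_alt) 
      (use C in \<open>simp_all add: q_def Q.emeasure_eq_measure cong: sets_pair_measure_cong\<close>)
  finally show ?thesis .
qed

section \<open>The intensity measure \<open>1 / x^2 dx\<close> on the positive half-line\<close>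

lemma sets_frechet_intensity [measurable_cong]: "sets frechet_intensity = sets (restrict_space borel {0<..})"
  by (simp add: frechet_intensity_def cong: sets_restrict_space_cong)

lemma space_frechet_intensity [simp]: "space frechet_intensity = {0<..}"
  by (simp add: frechet_intensity_def space_restrict_space)

lemma nn_integral_frechet_intensity:
  assumes [measurable]: "f \<in> borel_measurable borel"
  shows "(\<integral>\<^sup>+p. f p \<partial>frechet_intensity) = (\<integral>\<^sup>+p. ennreal (1 / p\<^sup>2) * f p * indicator {0<..} p \<partial>lborel)"
proof -
  have "f \<in> borel_measurable (restrict_space lborel {0<..})"
    by (intro measurable_restrict_space1) auto
  moreover have "(\<lambda>p. ennreal (1 / p\<^sup>2)) \<in> borel_measurable (restrict_space lborel {0<..})"
    by (intro measurable_restrict_space1) auto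
  ultimately show ?thesis
    unfolding frechet_intensity_def
    by (subst nn_integral_density) (auto simp: nn_integral_restrict_space)
qed

lemma emeasure_frechet_intensity:
  assumes "c > 0"
  shows "emeasure frechet_intensity {c<..} = ennreal (1 / c)"
proof -
  have c: "{c<..} \<in> sets frechet_intensity"
    unfolding sets_frechet_intensity using assms by (auto simp: sets_restrict_space_iff)
  have "emeasure frechet_intensity {c<..} = (\<integral>\<^sup>+p. indicator {c<..} p \<partial>frechet_intensity)"
    using c by simp
  also have "\<dots> = (\<integral>\<^sup>+p. ennreal (1 / p\<^sup>2) * indicator {c<..} p * indicator {0<..} p \<partial>lborel)"
    by (rule nn_integral_frechet_intensity) measurable
  \<comment> \<open>The endpoint is a null set; it is added because the fundamental theorem of
    calculus is applied on a closed half-line, with antiderivative \<open>- 1 / x\<close>.\<close>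
  also have "\<dots> = (\<integral>\<^sup>+p. ennreal (1 / p\<^sup>2) * indicator {c..} p \<partial>lborel)"
    using assms AE_lborel_singleton[of c]
    by (intro nn_integral_cong_AE) (auto split: split_indicator)
  also have "\<dots> = ennreal (0 - (- 1 / c))"
  proof (rule nn_integral_FTC_atLeast)
    show "((\<lambda>x. - 1 / x) has_real_derivative 1 / x\<^sup>2) (at x)" if "c \<le> x" for x
      using that assms by (auto intro!: derivative_eq_intros simp: power2_eq_square)
    show "((\<lambda>x::real. - 1 / x) \<longlongrightarrow> 0) at_top"
      by (intro real_tendsto_divide_at_top[OF tendsto_const] filterlim_ident)
  qed auto
  finally show ?thesis by simp
qed

text \<open>The half-lines above \<open>1 / (n + 1)\<close> have mass \<open>n + 1\<close> and
  exhaust the space. Sigma-finiteness is what permits integrating over the points before the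
  paths.\<close>

lemma sigma_finite_frechet_intensity: "sigma_finite_measure frechet_intensity"
proof
  show "\<exists>A. countable A \<and> A \<subseteq> sets frechet_intensity \<and> \<Union> A = space frechet_intensity \<and>
      (\<forall>a\<in>A. emeasure frechet_intensity a \<noteq> \<infinity>)"
  proof (intro exI[of _ "range (\<lambda>n. {1 / real (Suc n)<..})"] conjI ballI)
    show "range (\<lambda>n. {1 / real (Suc n)<..}) \<subseteq> sets frechet_intensity"
      unfolding sets_frechet_intensity by (auto simp: sets_restrict_space_iff intro: le_less_trans[rotated])
    show "\<Union> (range (\<lambda>n. {1 / real (Suc n)<..})) = space frechet_intensity"
    proof safe
      fix x :: real assume "x \<in> space frechet_intensity"
      then have "x > 0" by simp
      from reals_Archimedean[OF this] show "x \<in> \<Union> (range (\<lambda>n. {1 / real (Suc n)<..}))"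
        by (auto simp: inverse_eq_divide)
    qed (auto intro: less_trans[rotated])
  qed (auto simp: emeasure_frechet_intensity)
qed

section \<open>Expected maxima and the extremal index\<close>

text \<open>Fekete's lemma. Subadditivity is assumed for positive arguments only, since
  \<open>a 0\<close> will be the mean of a maximum over the empty set; division with remainder is
  arranged to avoid \<open>0\<close>.\<close>

lemma subadditive_limit:
  fixes a :: "nat \<Rightarrow> real"
  assumes sub: "\<And>m n. 0 < m \<Longrightarrow> 0 < n \<Longrightarrow> a (m + n) \<le> a m + a n"
    and nonneg: "\<And>n. 0 < n \<Longrightarrow> 0 \<le> a n"
  shows "(\<lambda>n. a n / real n) \<longlonglongrightarrow> (INF n\<in>{0<..}. a n / real n)"
proof -
  define L where "L = (INF n\<in>{0<..}. a n / real n)"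
  have bdd: "bdd_below ((\<lambda>n. a n / real n) ` {0<..})"
    using nonneg by (intro bdd_belowI[of _ 0]) auto
  have lower: "L \<le> a n / real n" if "n > 0" for n
    unfolding L_def using that by (intro cINF_lower bdd) auto
  have iterate: "a (q * m + s) \<le> real q * a m + a s" if "m > 0" "s > 0" for q m s
  proof (induction q)
    case (Suc q)
    have "a (m + (q * m + s)) \<le> a m + a (q * m + s)"
      using that by (intro sub) auto
    with Suc show ?case by (simp add: algebra_simps)
  qed simp
  have upper: "\<forall>\<^sub>F n in sequentially. a n / real n < L + e" if e: "e > 0" for e
  proof -
    obtain m where m: "m > 0" "a m / real m < L + e"
      using cINF_less_iff[OF _ bdd, of "L + e"] e by (auto simp: L_def)
    \<comment> \<open>A bound for all possible remainder terms, whose contribution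
      \<open>c / n\<close> vanishes in the limit.\<close>
    define c where "c = Max (a ` {1..m})"
    have "(\<lambda>n. a m / real m + c / real n) \<longlonglongrightarrow> a m / real m + 0"
      by (intro tendsto_intros lim_const_over_n)
    then have "\<forall>\<^sub>F n in sequentially. a m / real m + c / real n < L + e"
      using m by (intro order_tendstoD) auto
    then show ?thesis using eventually_gt_at_top[of 0]
    proof eventually_elim
      fix n :: nat assume n: "a m / real m + c / real n < L + e" "0 < n"
      \<comment> \<open>Dividing \<open>n - 1\<close> instead of \<open>n\<close> puts the remainder
        \<open>s\<close> into \<open>{1..m}\<close>, so it is never \<open>0\<close>.\<close>
      define q where "q = (n - 1) div m"
      define s where "s = Suc ((n - 1) mod m)"
      have eq: "n = q * m + s"
        using n(2) div_mult_mod_eq[of "n - 1" m] by (simp add: q_def s_def)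
      have s: "s \<in> {1..m}" using m(1) by (simp add: s_def Suc_leI)
      have "a n \<le> real q * a m + a s"
        using iterate[of m s q] m(1) s by (simp flip: eq)
      also have "a s \<le> c" unfolding c_def using s by simp
      also have "real q * a m \<le> real n * (a m / real m)"
      proof -
        have "real q * real m \<le> real n" unfolding eq by simp
        then have "real q * real m * (a m / real m) \<le> real n * (a m / real m)"
          using nonneg[OF m(1)] by (intro mult_right_mono) auto
        then show ?thesis using m(1) by simp
      qed
      finally have "a n / real n \<le> a m / real m + c / real n"
        using n(2) by (simp add: field_simps)
      with n(1) show "a n / real n < L + e" by linarith
    qed
  qed
  show ?thesis unfolding L_def[symmetric]
  proof (rule tendstoI)
    fix e :: real assume "e > 0"
    from upper[OF this] eventually_gt_at_top[of 0]
    show "\<forall>\<^sub>F n in sequentially. dist (a n / real n) L < e"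
      by eventually_elim (use lower in \<open>auto simp: dist_real_def abs_less_iff intro: le_less_trans[rotated]\<close>)
  qed
qed

text \<open>The quantity \<open>a K\<close> of the overview. When each \<open>exp (W t)\<close> has
  mean one, it is the extremal coefficient of the set of times \<open>K\<close>.\<close>

definition mean_max :: "'w measure \<Rightarrow> (real \<Rightarrow> 'w \<Rightarrow> real) \<Rightarrow> real set \<Rightarrow> real" where
  "mean_max M W K = (\<integral>\<omega>. Max ((\<lambda>t. exp (W t \<omega>)) ` K) \<partial>M)"

lemma mean_max_nonneg: "finite K \<Longrightarrow> K \<noteq> {} \<Longrightarrow> 0 \<le> mean_max M W K"
  unfolding mean_max_def by (intro integral_nonneg_AE AE_I2) (auto simp: Max_ge_iff)

section \<open>Joint distribution of the max-stable process at finitely many times\<close>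

locale brown_resnick =
  fixes M :: "'w measure" and W :: "real \<Rightarrow> 'w \<Rightarrow> real"
    and N :: "'v measure" and P :: "nat \<Rightarrow> 'v \<Rightarrow> real" and V :: "nat \<Rightarrow> real \<Rightarrow> 'v \<Rightarrow> real"
  assumes prob_M: "prob_space M" and prob_N: "prob_space N"
    and borel_W [measurable]: "W t \<in> borel_measurable M"
    and integrable_exp: "integrable M (\<lambda>\<omega>. exp (W t \<omega>))"
    and repr: "brown_resnick_representation M W N P V"
begin

lemma
  shows ppp: "poisson_point_process N frechet_intensity P"
    and borel_V [measurable]: "V i t \<in> borel_measurable N"
    and law_V: "path_law N (V i) = path_law M W"
    and indep_V: "prob_space.indep_vars N (\<lambda>_. \<Pi>\<^sub>M t\<in>UNIV. borel) (\<lambda>i \<omega> t. V i t \<omega>) UNIV"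
    and indep_P_V: "indep_elements N
       (\<Pi>\<^sub>M i\<in>UNIV. frechet_intensity) (\<lambda>\<omega> i. P i \<omega>)
       (\<Pi>\<^sub>M i\<in>UNIV. \<Pi>\<^sub>M t\<in>UNIV. borel) (\<lambda>\<omega> i t. V i t \<omega>)"
  using repr by (auto simp: brown_resnick_representation_def)

lemma borel_P [measurable]: "P i \<in> borel_measurable N"
proof -
  have "P i \<in> N \<rightarrow>\<^sub>M frechet_intensity"
    using ppp by (auto simp: poisson_point_process_def)
  then have "P i \<in> N \<rightarrow>\<^sub>M restrict_space borel {0<..}"
    by (simp cong: measurable_cong_sets add: sets_frechet_intensity)
  then show ?thesis
    by (auto simp: measurable_restrict_space2_iff)
qed

lemma P_pos: "\<omega> \<in> space N \<Longrightarrow> 0 < P i \<omega>"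
  using ppp measurable_space[of "P i" N frechet_intensity \<omega>]
  by (auto simp: poisson_point_process_def)

lemma borel_max_stable_process [measurable]: "max_stable_process P V t \<in> borel_measurable N"
  unfolding max_stable_process_def[abs_def] by measurable

lemma integrable_Max:
  assumes "finite K" "K \<noteq> {}"
  shows "integrable M (\<lambda>\<omega>. Max ((\<lambda>t. exp (W t \<omega>)) ` K))"
proof (rule Bochner_Integration.integrable_bound)
  show "integrable M (\<lambda>\<omega>. \<Sum>t\<in>K. exp (W t \<omega>))"
    by (intro Bochner_Integration.integrable_sum integrable_exp)
  show "(\<lambda>\<omega>. Max ((\<lambda>t. exp (W t \<omega>)) ` K)) \<in> borel_measurable M"
    using assms by measurable
  have "0 \<le> Max ((\<lambda>t. exp (W t \<omega>)) ` K) \<and> Max ((\<lambda>t. exp (W t \<omega>)) ` K) \<le> (\<Sum>t\<in>K. exp (W t \<omega>))" for \<omega>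
    using assms by (auto simp: Max_ge_iff intro!: member_le_sum)
  then show "AE \<omega> in M. norm (Max ((\<lambda>t. exp (W t \<omega>)) ` K)) \<le> norm (\<Sum>t\<in>K. exp (W t \<omega>))"
    by (intro AE_I2) (metis abs_of_nonneg order_trans real_norm_def)
qed

text \<open>Both maxima are nonnegative, so the larger one is at most their sum.\<close>

lemma mean_max_Un:
  assumes "finite K" "K \<noteq> {}" "finite L" "L \<noteq> {}"
  shows "mean_max M W (K \<union> L) \<le> mean_max M W K + mean_max M W L"
proof -
  have "mean_max M W (K \<union> L) \<le> (\<integral>\<omega>. Max ((\<lambda>t. exp (W t \<omega>)) ` K) + Max ((\<lambda>t. exp (W t \<omega>)) ` L) \<partial>M)"
    unfolding mean_max_def
  proof (rule integral_mono)
    fix \<omega>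
    have "0 \<le> Max ((\<lambda>t. exp (W t \<omega>)) ` K)" "0 \<le> Max ((\<lambda>t. exp (W t \<omega>)) ` L)"
      using assms by (auto simp: Max_ge_iff)
    then show "Max ((\<lambda>t. exp (W t \<omega>)) ` (K \<union> L)) \<le> Max ((\<lambda>t. exp (W t \<omega>)) ` K) + Max ((\<lambda>t. exp (W t \<omega>)) ` L)"
      using assms by (simp add: image_Un Max_Un)
  qed (use assms in \<open>auto intro!: integrable_Max Bochner_Integration.integrable_add\<close>)
  also have "\<dots> = mean_max M W K + mean_max M W L"
    unfolding mean_max_def using assms by (intro Bochner_Integration.integral_add integrable_Max)
  finally show ?thesis .
qed

text \<open>The process stays below \<open>x\<close> on \<open>K\<close> exactly if no pair of a
  point \<open>p\<close> and a path \<open>f\<close> satisfies \<open>p * \<psi> f > x\<close>,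
  where \<open>\<psi> f\<close> is the maximum of \<open>exp (f t)\<close> over \<open>K\<close>.
  This is a void event of the marked Poisson process.\<close>

lemma max_stable_distribution:
  assumes K: "finite K" "K \<noteq> {}" and x: "0 < x"
  shows "measure N {\<omega> \<in> space N. \<forall>t\<in>K. max_stable_process P V t \<omega> \<le> ennreal x} = exp (- mean_max M W K / x)"
proof -
  interpret M: prob_space M by (rule prob_M)
  interpret N: prob_space N by (rule prob_N)
  let ?S = "\<Pi>\<^sub>M t\<in>(UNIV::real set). (borel :: real measure)"
  have W_path[measurable]: "(\<lambda>\<omega> t. W t \<omega>) \<in> M \<rightarrow>\<^sub>M ?S"
    by (intro measurable_PiM_single') auto
  have V_path[measurable]: "(\<lambda>\<omega> t. V i t \<omega>) \<in> N \<rightarrow>\<^sub>M ?S" for i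
    by (intro measurable_PiM_single') auto
  define \<psi> where "\<psi> f = Max ((\<lambda>t. exp (f t)) ` K)" for f :: "real \<Rightarrow> real"
  have \<psi>[measurable]: "\<psi> \<in> borel_measurable ?S"
    unfolding \<psi>_def[abs_def] using K(1) by measurable
  have \<psi>_pos: "0 < \<psi> f" for f
    using K by (auto simp: \<psi>_def Max_gr_iff)
  let ?Q = "path_law M W"
  have sets_Q[measurable_cong]: "sets ?Q = sets ?S" by (simp add: path_law_def)
  interpret Q: prob_space ?Q unfolding path_law_def by (rule M.prob_space_distr) measurable
  interpret F: sigma_finite_measure frechet_intensity by (rule sigma_finite_frechet_intensity)
  interpret FQ: pair_sigma_finite frechet_intensity ?Q ..
  have id[measurable]: "(\<lambda>p. p) \<in> borel_measurable frechet_intensity"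
    unfolding measurable_cong_sets[OF sets_frechet_intensity refl] by (rule measurable_restrict_space1) auto
  define C where "C = {z \<in> space (frechet_intensity \<Otimes>\<^sub>M ?S). x < fst z * \<psi> (snd z)}"
  have "(\<lambda>z. fst z * \<psi> (snd z)) \<in> borel_measurable (frechet_intensity \<Otimes>\<^sub>M ?S)"
    by (intro borel_measurable_times measurable_compose[OF measurable_fst id] measurable_compose[OF measurable_snd \<psi>])
  then have C[measurable]: "C \<in> sets (frechet_intensity \<Otimes>\<^sub>M ?S)"
    unfolding C_def by measurable
  have C_Q: "C \<in> sets (frechet_intensity \<Otimes>\<^sub>M ?Q)"
    using C sets_pair_measure_cong[OF refl sets_Q, of frechet_intensity] by simp
  have "{\<omega> \<in> space N. \<forall>t\<in>K. max_stable_process P V t \<omega> \<le> ennreal x} =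
      {\<omega> \<in> space N. \<forall>i. (P i \<omega>, \<lambda>t. V i t \<omega>) \<notin> C}"
  proof (intro Collect_cong conj_cong refl)
    fix \<omega> assume \<omega>: "\<omega> \<in> space N"
    have "(\<forall>t\<in>K. max_stable_process P V t \<omega> \<le> ennreal x) \<longleftrightarrow> (\<forall>i. \<forall>t\<in>K. P i \<omega> * exp (V i t \<omega>) \<le> x)"
      using x by (auto simp: max_stable_process_def SUP_le_iff ennreal_le_iff)
    also have "\<dots> \<longleftrightarrow> (\<forall>i. P i \<omega> * \<psi> (\<lambda>t. V i t \<omega>) \<le> x)"
    proof (intro all_cong1)
      fix i
      \<comment> \<open>Dividing by the positive point isolates the path, so that the condition at
        all times becomes one on the maximum.\<close>
      have "(\<forall>t\<in>K. P i \<omega> * exp (V i t \<omega>) \<le> x) \<longleftrightarrow> (\<forall>t\<in>K. exp (V i t \<omega>) \<le> x / P i \<omega>)"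
        using P_pos[OF \<omega>, of i] by (simp add: pos_le_divide_eq mult.commute)
      also have "\<dots> \<longleftrightarrow> \<psi> (\<lambda>t. V i t \<omega>) \<le> x / P i \<omega>"
        using K by (simp add: \<psi>_def)
      also have "\<dots> \<longleftrightarrow> P i \<omega> * \<psi> (\<lambda>t. V i t \<omega>) \<le> x"
        using P_pos[OF \<omega>, of i] by (simp add: pos_le_divide_eq mult.commute)
      finally show "(\<forall>t\<in>K. P i \<omega> * exp (V i t \<omega>) \<le> x) \<longleftrightarrow> P i \<omega> * \<psi> (\<lambda>t. V i t \<omega>) \<le> x" .
    qed
    also have "\<dots> \<longleftrightarrow> (\<forall>i. (P i \<omega>, \<lambda>t. V i t \<omega>) \<notin> C)"
      using P_pos[OF \<omega>] by (auto simp: C_def space_pair_measure space_PiM not_less)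
    finally show "(\<forall>t\<in>K. max_stable_process P V t \<omega> \<le> ennreal x) \<longleftrightarrow> (\<forall>i. (P i \<omega>, \<lambda>t. V i t \<omega>) \<notin> C)" .
  qed
  then have "measure N {\<omega> \<in> space N. \<forall>t\<in>K. max_stable_process P V t \<omega> \<le> ennreal x} =
      exp_neg (emeasure (frechet_intensity \<Otimes>\<^sub>M ?Q) C)"
    using marked_poisson_void_probability[OF prob_N ppp V_path law_V[unfolded path_law_def] indep_V indep_P_V C]
    by (simp add: path_law_def)
  \<comment> \<open>Fubini with the path outside: for a fixed path \<open>f\<close> the section of
    \<open>C\<close> is the half-line above \<open>x / \<psi> f\<close>, of mass
    \<open>\<psi> f / x\<close>.\<close>
  also have "emeasure (frechet_intensity \<Otimes>\<^sub>M ?Q) C =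
      (\<integral>\<^sup>+f. emeasure frechet_intensity ((\<lambda>p. (p, f)) -` C) \<partial>?Q)"
    by (rule FQ.emeasure_pair_measure_alt2[OF C_Q])
  also have "\<dots> = (\<integral>\<^sup>+f. ennreal (\<psi> f / x) \<partial>?Q)"
  proof (rule nn_integral_cong)
    fix f assume "f \<in> space ?Q"
    have "(\<lambda>p. (p, f)) -` C = {x / \<psi> f<..}"
      using \<psi>_pos[of f] x
      by (auto simp: C_def space_pair_measure space_PiM pos_divide_less_eq intro: less_trans[OF divide_pos_pos])
    then show "emeasure frechet_intensity ((\<lambda>p. (p, f)) -` C) = ennreal (\<psi> f / x)"
      using \<psi>_pos[of f] x by (simp add: emeasure_frechet_intensity)
  qed
  also have "\<dots> = (\<integral>\<^sup>+\<omega>. ennreal (\<psi> (\<lambda>t. W t \<omega>) / x) \<partial>M)"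
    unfolding path_law_def by (rule nn_integral_distr) measurable
  also have "\<dots> = ennreal (\<integral>\<omega>. \<psi> (\<lambda>t. W t \<omega>) / x \<partial>M)"
    using \<psi>_pos x integrable_Max[OF K]
    by (intro nn_integral_eq_integral) (auto simp: \<psi>_def less_imp_le)
  also have "(\<integral>\<omega>. \<psi> (\<lambda>t. W t \<omega>) / x \<partial>M) = mean_max M W K / x"
    by (simp add: \<psi>_def mean_max_def)
  finally show ?thesis
    using mean_max_nonneg[OF K, of M W] x by (simp add: exp_neg_ennreal)
qed

text \<open>The probability of staying below level \<open>1\<close> on \<open>K\<close> depends only
  on the law of the process and equals \<open>exp (- mean_max M W K)\<close>. Stationarity preserves
  it under shifts, and \<open>exp\<close> is injective.\<close>

lemma mean_max_shift:
  assumes stat: "stationary N (max_stable_process P V)" and K: "finite K" "K \<noteq> {}"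
  shows "mean_max M W ((\<lambda>t. t + h) ` K) = mean_max M W K"
proof -
  let ?\<xi> = "max_stable_process P V"
  let ?S = "\<Pi>\<^sub>M t\<in>(UNIV::real set). (borel :: ennreal measure)"
  define A where "A = {f \<in> space ?S. \<forall>t\<in>K. f t \<le> ennreal 1}"
  have A: "A \<in> sets ?S" unfolding A_def using K(1) by measurable
  have law: "measure (path_law N (\<lambda>t. ?\<xi> (t + s))) A = exp (- mean_max M W ((\<lambda>t. t + s) ` K))" for s
  proof -
    have "(\<lambda>\<omega> t. ?\<xi> (t + s) \<omega>) \<in> N \<rightarrow>\<^sub>M ?S"
      by (intro measurable_PiM_single') auto
    then have "measure (path_law N (\<lambda>t. ?\<xi> (t + s))) A =
        measure N ((\<lambda>\<omega> t. ?\<xi> (t + s) \<omega>) -` A \<inter> space N)"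
      unfolding path_law_def using A by (rule measure_distr)
    also have "(\<lambda>\<omega> t. ?\<xi> (t + s) \<omega>) -` A \<inter> space N =
        {\<omega> \<in> space N. \<forall>t\<in>(\<lambda>t. t + s) ` K. ?\<xi> t \<omega> \<le> ennreal 1}"
      by (auto simp: A_def space_PiM)
    finally show ?thesis
      using K max_stable_distribution[of "(\<lambda>t. t + s) ` K" 1] by simp
  qed
  \<comment> \<open>The unshifted process is written as a shift by \<open>0\<close> so that
    \<open>law\<close> evaluates both sides.\<close>
  have "path_law N (\<lambda>t. ?\<xi> (t + h)) = path_law N (\<lambda>t. ?\<xi> (t + 0))"
    using stat by (simp add: stationary_def)
  then have "exp (- mean_max M W ((\<lambda>t. t + h) ` K)) = exp (- mean_max M W ((\<lambda>t. t + 0) ` K))"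
    using law by metis
  then show ?thesis by simp
qed

section \<open>Growth of the grid means and the Pickands constant\<close>

definition grid_mean :: "real \<Rightarrow> nat \<Rightarrow> real" where
  "grid_mean \<delta> n = mean_max M W ((\<lambda>k. \<delta> * real k) ` {..<n})"

lemma grid_mean_nonneg: "0 < n \<Longrightarrow> 0 \<le> grid_mean \<delta> n"
  unfolding grid_mean_def by (intro mean_max_nonneg) auto

text \<open>As \<open>n\<close> counts grid points, \<open>m + n\<close> points split into the first
  \<open>m\<close> and a translate of the first \<open>n\<close>. Shift invariance makes the
  sequence subadditive, and Fekete's lemma applies.\<close>

lemma grid_mean_limit:
  assumes stat: "stationary N (max_stable_process P V)"
  shows "\<exists>L\<ge>0. (\<lambda>n. grid_mean \<delta> n / real n) \<longlonglongrightarrow> L"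
proof (intro exI conjI)
  show lim: "(\<lambda>n. grid_mean \<delta> n / real n) \<longlonglongrightarrow> (INF n\<in>{0<..}. grid_mean \<delta> n / real n)"
  proof (rule subadditive_limit)
    fix m n :: nat assume mn: "0 < m" "0 < n"
    let ?K = "\<lambda>n. (\<lambda>k. \<delta> * real k) ` {..<n}"
    have "{..<m + n} = {..<m} \<union> (\<lambda>k. k + m) ` {..<n}"
      by (simp add: lessThan_atLeast0 ivl_disj_un(17) add.commute)
    then have "?K (m + n) = ?K m \<union> (\<lambda>t. t + \<delta> * real m) ` ?K n"
      by (simp add: image_Un image_image algebra_simps)
    then have "grid_mean \<delta> (m + n) \<le> mean_max M W (?K m) + mean_max M W ((\<lambda>t. t + \<delta> * real m) ` ?K n)"
      unfolding grid_mean_def using mn by (simp only:) (intro mean_max_Un, auto)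
    also have "mean_max M W ((\<lambda>t. t + \<delta> * real m) ` ?K n) = mean_max M W (?K n)"
      using mn by (intro mean_max_shift stat) auto
    finally show "grid_mean \<delta> (m + n) \<le> grid_mean \<delta> m + grid_mean \<delta> n"
      by (simp add: grid_mean_def)
  qed (rule grid_mean_nonneg)
  show "0 \<le> (INF n\<in>{0<..}. grid_mean \<delta> n / real n)"
    by (intro cINF_greatest) (auto intro!: divide_nonneg_nonneg grid_mean_nonneg)
qed

text \<open>The multiples of \<open>\<delta>\<close> in \<open>{0..T}\<close> have indices from
  \<open>0\<close> to the floor of \<open>T / \<delta>\<close>, which accounts for the
  \<open>Suc\<close>; over this finite nonempty set the supremum is a maximum.\<close>

lemma pickands_average_eq:
  assumes \<delta>: "0 < \<delta>" and T: "0 \<le> T"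
  shows "pickands_average M W \<delta> T = grid_mean \<delta> (Suc (nat \<lfloor>T / \<delta>\<rfloor>)) / T"
proof -
  have "range (\<lambda>k::int. \<delta> * of_int k) \<inter> {0..T} = (\<lambda>k. \<delta> * real k) ` {..<Suc (nat \<lfloor>T / \<delta>\<rfloor>)}"
  proof safe
    fix k :: int assume "\<delta> * of_int k \<in> {0..T}"
    then have "0 \<le> k" "of_int k \<le> T / \<delta>"
      using \<delta> by (auto simp: zero_le_mult_iff field_simps)
    then have "0 \<le> k" "k \<le> \<lfloor>T / \<delta>\<rfloor>" by (auto simp: le_floor_iff)
    then show "\<delta> * of_int k \<in> (\<lambda>k. \<delta> * real k) ` {..<Suc (nat \<lfloor>T / \<delta>\<rfloor>)}"
      by (intro image_eqI[of _ _ "nat k"]) auto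
  next
    fix k assume "k < Suc (nat \<lfloor>T / \<delta>\<rfloor>)"
    then have "int k \<le> \<lfloor>T / \<delta>\<rfloor>" using \<delta> T by (simp add: less_Suc_eq_le le_nat_iff)
    then have "real k \<le> T / \<delta>" by (simp add: le_floor_iff)
    then show "\<delta> * real k \<in> {0..T}" using \<delta> by (simp add: field_simps)
    show "\<delta> * real k \<in> range (\<lambda>k::int. \<delta> * of_int k)"
      by (intro image_eqI[of _ _ "int k"]) auto
  qed
  moreover have "(SUP t\<in>K. exp (W t \<omega>)) = Max ((\<lambda>t. exp (W t \<omega>)) ` K)" if "finite K" "K \<noteq> {}" for K \<omega>
    using that by (intro cSup_eq_Max) auto
  ultimately show ?thesis
    by (simp add: pickands_average_def grid_mean_def mean_max_def lessThan_Suc_atMost del: lessThan_Suc)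
qed

text \<open>With \<open>n T\<close> grid points up to time \<open>T\<close>, the average factors as
  \<open>grid_mean \<delta> (n T) / n T\<close> times \<open>n T / T\<close>. Rounding costs at most
  one point, so the second factor lies between \<open>1 / \<delta>\<close> and
  \<open>1 / \<delta> + 1 / T\<close>.\<close>

lemma pickands_average_limit:
  assumes \<delta>: "0 < \<delta>" and L: "(\<lambda>n. grid_mean \<delta> n / real n) \<longlonglongrightarrow> L"
  shows "(pickands_average M W \<delta> \<longlongrightarrow> L / \<delta>) at_top"
proof -
  define n where "n T = Suc (nat \<lfloor>T / \<delta>\<rfloor>)" for T
  have n_ge: "T / \<delta> \<le> real (n T)" for T unfolding n_def by linarith
  have n_le: "real (n T) \<le> T / \<delta> + 1" if "T \<ge> 0" for T
  proof -
    have "0 \<le> T / \<delta>" using that \<delta> by simp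
    then show ?thesis unfolding n_def by linarith
  qed
  have n_top: "filterlim n at_top at_top"
  proof -
    have "filterlim (\<lambda>T. T / \<delta>) at_top at_top"
      using filterlim_tendsto_pos_mult_at_top[OF tendsto_const[of "1 / \<delta>"] _ filterlim_ident] \<delta> by simp
    then have "filterlim (\<lambda>T. real (n T)) at_top at_top"
      by (rule filterlim_at_top_mono) (simp add: n_ge)
    then show ?thesis
      by (simp add: filterlim_sequentially_iff_filterlim_real)
  qed
  have "((\<lambda>T. real (n T) / T) \<longlongrightarrow> 1 / \<delta>) at_top"
  proof (rule tendsto_sandwich)
    show "\<forall>\<^sub>F T in at_top. 1 / \<delta> \<le> real (n T) / T"
      using eventually_gt_at_top[of 0]
    proof eventually_elim
      fix T :: real assume "0 < T"
      then show "1 / \<delta> \<le> real (n T) / T"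
        using n_ge[of T] \<delta> by (simp add: field_simps)
    qed
    show "\<forall>\<^sub>F T in at_top. real (n T) / T \<le> 1 / \<delta> + 1 / T"
      using eventually_gt_at_top[of 0]
    proof eventually_elim
      fix T :: real assume "0 < T"
      then show "real (n T) / T \<le> 1 / \<delta> + 1 / T"
        using n_le[of T] \<delta> by (simp add: field_simps)
    qed
    have "((\<lambda>T. 1 / \<delta> + 1 / T) \<longlongrightarrow> 1 / \<delta> + 0) at_top"
      by (intro tendsto_intros real_tendsto_divide_at_top[OF tendsto_const] filterlim_ident)
    then show "((\<lambda>T. 1 / \<delta> + 1 / T) \<longlongrightarrow> 1 / \<delta>) at_top" by simp
  qed simp
  from tendsto_mult[OF filterlim_compose[OF L n_top] this]
  have "((\<lambda>T. grid_mean \<delta> (n T) / real (n T) * (real (n T) / T)) \<longlongrightarrow> L / \<delta>) at_top" by simp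
  then show ?thesis
  proof (rule Lim_transform_eventually)
    show "\<forall>\<^sub>F T in at_top. grid_mean \<delta> (n T) / real (n T) * (real (n T) / T) = pickands_average M W \<delta> T"
      using eventually_ge_at_top[of 0]
      by eventually_elim (simp add: pickands_average_eq[OF \<delta>] n_def)
  qed
qed

section \<open>Exceedance probabilities over blocks of the grid\<close>

lemma grid_exceedance_probability:
  assumes "0 < n"
  shows "measure N {\<omega> \<in> space N. Max ((\<lambda>k. max_stable_process P V (\<delta> * real k) \<omega>) ` {0..m}) > of_nat n}
    = 1 - exp (- (grid_mean \<delta> (Suc m) / real n))"
proof -
  interpret N: prob_space N by (rule prob_N)
  let ?K = "(\<lambda>k. \<delta> * real k) ` {..<Suc m}"
  let ?A = "{\<omega> \<in> space N. \<forall>t\<in>?K. max_stable_process P V t \<omega> \<le> ennreal (real n)}"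
  have A: "?A \<in> sets N" by measurable
  have "{\<omega> \<in> space N. Max ((\<lambda>k. max_stable_process P V (\<delta> * real k) \<omega>) ` {0..m}) > of_nat n} = space N - ?A"
    by (auto simp: ennreal_of_nat_eq_real_of_nat lessThan_Suc_atMost simp flip: not_le simp del: lessThan_Suc)
  then have "measure N {\<omega> \<in> space N. Max ((\<lambda>k. max_stable_process P V (\<delta> * real k) \<omega>) ` {0..m}) > of_nat n}
      = 1 - measure N ?A"
    using N.prob_compl[OF A] by simp
  also have "measure N ?A = exp (- mean_max M W ?K / real n)"
    using assms by (intro max_stable_distribution) auto
  finally show ?thesis by (simp add: grid_mean_def)
qed

text \<open>The exceedance probability is \<open>1 - exp (- u n)\<close>, which lies between
  \<open>u n / (1 + u n)\<close> and \<open>u n\<close>. Scaling by \<open>n / r n\<close> turns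
  these bounds into \<open>b n / (1 + u n)\<close> and \<open>b n\<close>, where \<open>b\<close>
  tends to \<open>L\<close> and \<open>u\<close> to \<open>0\<close>.\<close>

lemma grid_exceedance_limit:
  assumes L: "(\<lambda>n. grid_mean \<delta> n / real n) \<longlonglongrightarrow> L"
    and r_pos: "\<And>n. n \<ge> 1 \<Longrightarrow> r n > 0"
    and r: "filterlim r at_top sequentially"
    and nr: "filterlim (\<lambda>n. real n / real (r n)) at_top sequentially"
  shows "(\<lambda>n. real n / real (r n) *
    measure N {\<omega> \<in> space N. Max ((\<lambda>k. max_stable_process P V (\<delta> * real k) \<omega>) ` {0..r n}) > of_nat n})
    \<longlonglongrightarrow> L"
proof -
  define b where "b n = grid_mean \<delta> (Suc (r n)) / real (r n)" for n
  define u where "u n = grid_mean \<delta> (Suc (r n)) / real n" for n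
  have u_nonneg: "0 \<le> u n" for n
    by (simp add: u_def grid_mean_nonneg)
  have b: "b \<longlonglongrightarrow> L"
  proof -
    have Suc_r: "filterlim (\<lambda>n. Suc (r n)) at_top sequentially"
      using filterlim_compose[OF filterlim_Suc r] .
    \<comment> \<open>The block from \<open>0\<close> to \<open>r n\<close> has
      \<open>r n + 1\<close> points but is normalised by \<open>r n\<close>; this factor corrects
      the mismatch.\<close>
    have "(\<lambda>n. 1 + 1 / real (r n)) \<longlonglongrightarrow> 1 + 0"
      by (intro tendsto_intros real_tendsto_divide_at_top[OF tendsto_const]
        filterlim_compose[OF filterlim_real_sequentially r])
    from tendsto_mult[OF filterlim_compose[OF L Suc_r] this]
    have "(\<lambda>n. grid_mean \<delta> (Suc (r n)) / real (Suc (r n)) * (1 + 1 / real (r n))) \<longlonglongrightarrow> L" by simp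
    then show ?thesis
    proof (rule Lim_transform_eventually)
      show "\<forall>\<^sub>F n in sequentially. grid_mean \<delta> (Suc (r n)) / real (Suc (r n)) * (1 + 1 / real (r n)) = b n"
        using eventually_ge_at_top[of 1]
      proof eventually_elim
        fix n :: nat assume "1 \<le> n"
        then have "1 + 1 / real (r n) = real (Suc (r n)) / real (r n)"
          using r_pos by (simp add: field_simps)
        then show "grid_mean \<delta> (Suc (r n)) / real (Suc (r n)) * (1 + 1 / real (r n)) = b n"
          by (simp add: b_def)
      qed
    qed
  qed
  have b_u: "real n / real (r n) * u n = b n" if "1 \<le> n" for n
    using that by (simp add: u_def b_def)
  have u: "u \<longlonglongrightarrow> 0"
  proof -
    \<comment> \<open>Blocks short compared with \<open>n\<close> enter here: \<open>u n\<close> is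
      the convergent \<open>b n\<close> divided by the diverging \<open>n / r n\<close>.\<close>
    have "(\<lambda>n. b n / (real n / real (r n))) \<longlonglongrightarrow> 0"
      by (rule real_tendsto_divide_at_top[OF b nr])
    then show ?thesis
    proof (rule Lim_transform_eventually)
      show "\<forall>\<^sub>F n in sequentially. b n / (real n / real (r n)) = u n"
        using eventually_ge_at_top[of 1]
        by eventually_elim (use r_pos in \<open>auto simp: b_def u_def\<close>)
    qed
  qed
  show ?thesis
  proof (rule tendsto_sandwich)
    let ?p = "\<lambda>n. measure N {\<omega> \<in> space N. Max ((\<lambda>k. max_stable_process P V (\<delta> * real k) \<omega>) ` {0..r n}) > of_nat n}"
    show "\<forall>\<^sub>F n in sequentially. b n / (1 + u n) \<le> real n / real (r n) * ?p n"
      using eventually_ge_at_top[of 1]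
    proof eventually_elim
      fix n :: nat assume n: "1 \<le> n"
      \<comment> \<open>The reciprocal of \<open>1 + u n \<le> exp (u n)\<close>.\<close>
      have "exp (- u n) \<le> 1 / (1 + u n)"
        using exp_ge_add_one_self[of "u n"] u_nonneg[of n] by (simp add: exp_minus field_simps)
      then have "u n / (1 + u n) \<le> 1 - exp (- u n)"
        using u_nonneg[of n] by (simp add: field_simps)
      then have "real n / real (r n) * (u n / (1 + u n)) \<le> real n / real (r n) * ?p n"
        using n by (intro mult_left_mono) (auto simp: grid_exceedance_probability u_def)
      then show "b n / (1 + u n) \<le> real n / real (r n) * ?p n"
        by (simp flip: b_u[OF n])
    qed
    show "\<forall>\<^sub>F n in sequentially. real n / real (r n) * ?p n \<le> b n"
      using eventually_ge_at_top[of 1]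
    proof eventually_elim
      fix n :: nat assume n: "1 \<le> n"
      have "1 - exp (- u n) \<le> u n"
        using exp_ge_add_one_self[of "- u n"] by simp
      then have "real n / real (r n) * ?p n \<le> real n / real (r n) * u n"
        using n by (intro mult_left_mono) (auto simp: grid_exceedance_probability u_def)
      then show "real n / real (r n) * ?p n \<le> b n"
        using b_u[OF n] by simp
    qed
    have "(\<lambda>n. b n / (1 + u n)) \<longlonglongrightarrow> L / (1 + 0)"
      by (intro tendsto_intros b u) auto
    then show "(\<lambda>n. b n / (1 + u n)) \<longlonglongrightarrow> L" by simp
  qed (rule b)
qed

end

theorem lemma1p1:
  fixes M :: "'w measure" and B W :: "real \<Rightarrow> 'w \<Rightarrow> real"
    and N :: "'v measure" and P :: "nat \<Rightarrow> 'v \<Rightarrow> real" and V :: "nat \<Rightarrow> real \<Rightarrow> 'v \<Rightarrow> real"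
    and \<xi> :: "real \<Rightarrow> 'v \<Rightarrow> ennreal" and r :: "nat \<Rightarrow> nat" and \<delta> :: real
  assumes "prob_space M"
    and "\<And>t. B t \<in> borel_measurable M"
    and "\<And>\<omega>. \<omega> \<in> space M \<Longrightarrow> cadlag (\<lambda>t. B t \<omega>)"
    and "AE \<omega> in M. B 0 \<omega> = 0"
    and "\<And>t. integrable M (\<lambda>\<omega>. exp (B t \<omega>))"
    and "W = log_normalized M B"
    and "prob_space N"
    and "brown_resnick_representation M W N P V"
    and "\<xi> = max_stable_process P V"
    and "stationary N \<xi>"
    and "\<And>n. n \<ge> 1 \<Longrightarrow> r n > 0"
    and "filterlim r at_top sequentially"
    and "filterlim (\<lambda>n. real n / real (r n)) at_top sequentially"
    and "\<delta> > 0"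
  shows "(pickands_average M W \<delta> \<longlongrightarrow> pickands_const M W \<delta>) at_top
    \<and> (\<lambda>n. real n / real (r n) *
          measure N {\<omega> \<in> space N. Max ((\<lambda>k. \<xi> (\<delta> * real k) \<omega>) ` {0..r n}) > of_nat n})
        \<longlonglongrightarrow> extremal_index M W \<delta>
    \<and> extremal_index M W \<delta> \<ge> 0"
proof -
  interpret brown_resnick M W N P V
  proof (rule brown_resnick.intro)
    show "W t \<in> borel_measurable M" for t
      unfolding assms(6) log_normalized_def[abs_def] using assms(2) by measurable
    \<comment> \<open>Normalising divides \<open>exp (B t)\<close> by a constant, so integrability
      carries over.\<close>
    show "integrable M (\<lambda>\<omega>. exp (W t \<omega>))" for t
      unfolding assms(6) log_normalized_def exp_diff using assms(5) by simp
  qed (fact assms(1,7,8))+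
  obtain L where L: "0 \<le> L" "(\<lambda>n. grid_mean \<delta> n / real n) \<longlonglongrightarrow> L"
    using grid_mean_limit assms(9,10) by metis
  have avg: "(pickands_average M W \<delta> \<longlongrightarrow> L / \<delta>) at_top"
    by (rule pickands_average_limit[OF \<open>\<delta> > 0\<close> L(2)])
  \<comment> \<open>\<open>Lim\<close> denotes the limit only once convergence is known, which
    \<open>avg\<close> provides. The factor \<open>\<delta>\<close> in the extremal index then
    cancels, leaving \<open>L\<close>.\<close>
  then have const: "pickands_const M W \<delta> = L / \<delta>"
    unfolding pickands_const_def by (intro tendsto_Lim) auto
  then have "extremal_index M W \<delta> = L"
    using \<open>\<delta> > 0\<close> by (simp add: extremal_index_def)
  then show ?thesis
    using avg const L grid_exceedance_limit[OF L(2) assms(11-13)] assms(9) by simp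
qed

end
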